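(* Let $p\in(0,1)$ and $\gamma\in(0,\tfrac12]$ be constants, let $b=1/(1-p)$, and let $\alpha_{\rm STAT}=\frac{\log_b n}{\gamma(1-\gamma)}$. Let $G\sim G_{\mathrm{bip}}(n,p)$ and let $Z_\alpha(\gamma)$ denote the number of $\gamma$-balanced independent sets of size $\alpha$ in $G$. Then for any fixed $\epsilon\in(0,1)$, as $n\to\infty$: (S1) for $\alpha\ge(1+\epsilon)\alpha_{\rm STAT}$, $\mathbb{P}[Z_\alpha(\gamma)\ge 1]=\exp(-\Theta(\log^2 n))$; (S2) for $\alpha\le(1-\epsilon)\alpha_{\rm STAT}$, $\mathbb{P}[Z_\alpha(\gamma)\ge 1]\ge 1-\exp(-\Theta(\log n))$.
   Context: $G_{\mathrm{bip}}(n,p)$ is the random bipartite graph on disjoint vertex sets $L,R$ with $|L|=|R|=n$, in which each of the $n^2$ pairs in $L\times R$ is an edge independently with probability $p$ (there are no edges inside $L$ or inside $R$). An independent set $I$ of a bipartite graph with bipartition $(L,R)$ is $\gamma$-balanced if $\bigl||I\cap L|-\gamma|I|\bigr|<1$ or $\bigl||I\cap R|-\gamma|I|\bigr|<1$. Floor and ceiling operations are ignored (quantities such as $\alpha\gamma$ are treated as integers).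
   Formalization: (S1) fails for large α (for α > 2n the probability is 0), so the two-sided estimate exp(-Θ(log² n)) is stated only for α = O(log n), while the upper bound exp(-Ω(log² n)) is stated for every α ≥ (1+ε)α_STAT. *)

theory Defs
  imports "HOL-Probability.Probability" "HOL-Library.Landau_Symbols"
begin

text \<open>The two sides are disjoint copies of \<open>{..<n}\<close>. An edge is the unordered
  pair of its endpoints, and a graph on \<open>left_side n \<union> right_side n\<close> is given by its
  edge set.\<close>

type_synonym vertex = "nat + nat"
type_synonym edges = "vertex set set"

definition left_side :: "nat \<Rightarrow> vertex set" where
  "left_side n = Inl ` {..<n}"

definition right_side :: "nat \<Rightarrow> vertex set" where
  "right_side n = Inr ` {..<n}"

text \<open>\<^const>\<open>Pi_pmf\<close> is the product distribution: the coordinates, indexed by the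
  pairs in \<open>L \<times> R\<close>, are independent; the value \<open>False\<close> is taken off that index set.\<close>

definition G_bip :: "nat \<Rightarrow> real \<Rightarrow> edges pmf" where
  "G_bip n p =
     map_pmf (\<lambda>\<omega>. {{u, v} |u v. u \<in> left_side n \<and> v \<in> right_side n \<and> \<omega> (u, v)})
       (Pi_pmf (left_side n \<times> right_side n) False (\<lambda>_. bernoulli_pmf p))"

definition independent_set :: "vertex set \<Rightarrow> edges \<Rightarrow> vertex set \<Rightarrow> bool" where
  "independent_set V E I \<longleftrightarrow> I \<subseteq> V \<and> (\<forall>u\<in>I. \<forall>v\<in>I. {u, v} \<notin> E)"

definition balanced :: "vertex set \<Rightarrow> vertex set \<Rightarrow> real \<Rightarrow> vertex set \<Rightarrow> bool" where
  "balanced L R \<gamma> I \<longleftrightarrow>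
     \<bar>real (card (I \<inter> L)) - \<gamma> * real (card I)\<bar> < 1 \<or>
     \<bar>real (card (I \<inter> R)) - \<gamma> * real (card I)\<bar> < 1"

definition Z_bal :: "nat \<Rightarrow> real \<Rightarrow> nat \<Rightarrow> edges \<Rightarrow> nat" where
  "Z_bal n \<gamma> a E =
     card {I. independent_set (left_side n \<union> right_side n) E I \<and>
              balanced (left_side n) (right_side n) \<gamma> I \<and> card I = a}"

definition alpha_STAT :: "real \<Rightarrow> real \<Rightarrow> nat \<Rightarrow> real" where
  "alpha_STAT p \<gamma> n = log (1 / (1 - p)) (real n) / (\<gamma> * (1 - \<gamma>))"

definition prob_Z_pos :: "nat \<Rightarrow> real \<Rightarrow> real \<Rightarrow> nat \<Rightarrow> real" where
  "prob_Z_pos n p \<gamma> a = measure_pmf.prob (G_bip n p) {E. Z_bal n \<gamma> a E \<ge> 1}"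

text \<open>The Landau sets of the library compare absolute values, so \<open>\<Omega>\<close> and \<open>\<Theta>\<close>
  also contain negative functions, for which a bound \<open>exp (- f n)\<close> would be void.
  In an exponent only nonnegative functions are meant.\<close>

definition nonneg_Omega :: "(nat \<Rightarrow> real) \<Rightarrow> (nat \<Rightarrow> real) set" where
  "nonneg_Omega g = {f \<in> \<Omega>(g). \<forall>n. f n \<ge> 0}"

definition nonneg_Theta :: "(nat \<Rightarrow> real) \<Rightarrow> (nat \<Rightarrow> real) set" where
  "nonneg_Theta g = {f \<in> \<Theta>(g). \<forall>n. f n \<ge> 0}"

end

theory Submission
  imports Defs "HOL-Real_Asymp.Real_Asymp"
begin

text \<open>Upper tail: a balanced set of size \<open>a\<close> spans at least \<open>\<gamma>(1 - \<gamma>)a\<^sup>2 - a\<close> pairs, so a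
  union bound over the at most \<open>(2n)\<^sup>a\<close> sets of that size suffices; conversely a single balanced
  set is independent with probability at least \<open>(1 - p)\<close> to the power \<open>a\<^sup>2\<close>. Lower range: a
  second moment argument over the sets \<open>S \<union> T\<close> with \<open>S \<subseteq> L\<close>, \<open>T \<subseteq> R\<close>, \<open>|S| = i = \<lfloor>\<gamma>a\<rfloor>\<close>,
  \<open>|T| = j = a - i\<close>. If two such sets overlap in \<open>k\<close> left and \<open>l\<close> right vertices, their
  correlation is \<open>b\<close> to the power \<open>kl\<close>. Since \<open>kl/(k + l)\<close> is increasing in \<open>k\<close> and \<open>l\<close>, it is
  at most \<open>ij/a \<le> (1 - \<epsilon>) log\<^sub>b n + 1\<close>, which bounds the correlation by \<open>y\<close> to the power
  \<open>k + l\<close> with \<open>y = b n powr (1 - \<epsilon>)\<close>. The sum over all pairs thus factorizes into a left and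
  a right overlap sum, each polylogarithmic in \<open>n\<close> times \<open>n powr -\<epsilon>\<close>.\<close>

section \<open>Subset counts and overlap sums\<close>

text \<open>Removing \<open>A\<close> is injective on its supersets. Only an inequality is claimed:
  for \<open>i < card A\<close> no such \<open>S\<close> exists, while truncated subtraction turns
  the right side into 1.\<close>

lemma card_supersets_le:
  assumes "finite V" "A \<subseteq> V"
  shows "card {S. A \<subseteq> S \<and> S \<subseteq> V \<and> card S = i} \<le> (card V - card A) choose (i - card A)"
proof -
  have fA: "finite A" using assms finite_subset by blast
  have "card {S. A \<subseteq> S \<and> S \<subseteq> V \<and> card S = i} \<le> card {B. B \<subseteq> V - A \<and> card B = i - card A}"
  proof (rule card_inj_on_le)
    show "inj_on (\<lambda>S. S - A) {S. A \<subseteq> S \<and> S \<subseteq> V \<and> card S = i}"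
      by (rule inj_onI) blast
    show "(\<lambda>S. S - A) ` {S. A \<subseteq> S \<and> S \<subseteq> V \<and> card S = i} \<subseteq> {B. B \<subseteq> V - A \<and> card B = i - card A}"
      using fA by (auto simp: card_Diff_subset)
    show "finite {B. B \<subseteq> V - A \<and> card B = i - card A}"
      using assms(1) by simp
  qed
  also have "\<dots> = card (V - A) choose (i - card A)"
    using assms(1) by (simp add: n_subsets)
  also have "card (V - A) = card V - card A"
    using assms fA by (simp add: card_Diff_subset)
  finally show ?thesis .
qed

text \<open>Division-free form of a probability bound: a uniform i-subset of n points contains k
  given points with probability at most (i/n)^k. Each induction step contributes a factor
  (i-k)/(n-k), which \<open>le\<close> compares with i/n.\<close>

lemma choose_diff_mult_power_le:
  assumes "k \<le> i" "i \<le> n"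
  shows "((n - k) choose (i - k)) * n ^ k \<le> (n choose i) * i ^ k"
  using assms(1)
proof (induction k)
  case (Suc k)
  define m r where "m = n - Suc k" and "r = i - Suc k"
  have m: "n - k = Suc m" and r: "i - k = Suc r"
    using Suc.prems assms(2) by (auto simp: m_def r_def)
  have le: "n * Suc r \<le> i * Suc m"
  proof -
    have eq: "n = Suc m + k" "i = Suc r + k" using m r Suc.prems assms(2) by linarith+
    have "k * Suc r \<le> k * Suc m" using m r assms(2) by (intro mult_le_mono2) linarith
    then show ?thesis unfolding eq by (simp add: algebra_simps)
  qed
  \<comment> \<open>The extra factor \<open>Suc m\<close> makes the absorption identity for
    binomials applicable; it is cancelled afterwards.\<close>
  have "Suc m * (n * (m choose r)) = n * (Suc m * (m choose r))" by (rule mult.left_commute)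
  also have "\<dots> = n * Suc r * (Suc m choose Suc r)"
    by (simp only: Suc_times_binomial[symmetric] mult.assoc)
  also have "\<dots> \<le> i * Suc m * (Suc m choose Suc r)" using le by (rule mult_le_mono1)
  also have "\<dots> = Suc m * (i * (Suc m choose Suc r))" by (simp only: ac_simps)
  finally have "Suc m * (n * (m choose r)) \<le> Suc m * (i * (Suc m choose Suc r))" .
  then have *: "n * (m choose r) \<le> i * (Suc m choose Suc r)"
    by (simp only: Suc_mult_le_cancel1)
  have "(m choose r) * n ^ Suc k = n * (m choose r) * n ^ k" by simp
  also have "\<dots> \<le> i * (Suc m choose Suc r) * n ^ k"
    using * by (rule mult_le_mono1)
  also have "\<dots> = i * ((n - k choose (i - k)) * n ^ k)" by (simp add: m r)
  also have "\<dots> \<le> i * ((n choose i) * i ^ k)"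
    using Suc by (intro mult_le_mono2) simp
  finally show ?case by (simp add: m_def r_def ac_simps)
qed simp

lemma sum_power_card_Pow:
  fixes x :: "'a :: comm_semiring_1"
  assumes "finite S"
  shows "(\<Sum>A\<in>Pow S. x ^ card A) = (1 + x) ^ card S"
proof -
  have "(1 + x) ^ card S = (\<Prod>a\<in>S. x + 1)"
    by (simp add: add.commute)
  also have "\<dots> = (\<Sum>A\<in>Pow S. x ^ card A)"
    using prod_add[OF assms, of "\<lambda>_. x" "\<lambda>_. 1"] by simp
  finally show ?thesis by simp
qed

text \<open>The weight of \<open>S'\<close> is dominated by the sum of y^|A| over all nonempty A
  contained in both \<open>S\<close> and \<open>S'\<close>. After exchanging the sums, the sets
  \<open>S'\<close> containing a fixed A are counted, and the binomial theorem sums over A.\<close>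

lemma sum_overlap_le:
  fixes y :: real
  assumes V: "finite V" and S: "S \<subseteq> V" "card S = i" and y: "y \<ge> 0"
  shows "(\<Sum>S' | S' \<subseteq> V \<and> card S' = i. if S \<inter> S' = {} then 0 else y ^ card (S \<inter> S'))
           \<le> real (card V choose i) * ((1 + y * real i / real (card V)) ^ i - 1)"
proof (cases "S = {}")
  case True
  then show ?thesis using S by simp
next
  case False
  define n w where "n = card V" and "w = y * real i / real n"
  define F where "F = {S'. S' \<subseteq> V \<and> card S' = i}"
  have fin: "finite F" "finite S" using V S finite_subset by (auto simp: F_def)
  have i: "i \<le> n" using S V card_mono by (auto simp: n_def)
  \<comment> \<open>\<open>w\<close> divides by \<open>n\<close>; the case of empty \<open>S\<close>
    was split off to make this positive.\<close>
  have n: "n > 0" using False S V by (auto simp: n_def card_gt_0_iff)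
  have "(\<Sum>S'\<in>F. if S \<inter> S' = {} then 0 else y ^ card (S \<inter> S'))
      \<le> (\<Sum>S'\<in>F. \<Sum>A\<in>Pow S - {{}}. if A \<subseteq> S' then y ^ card A else 0)"
  proof (rule sum_mono)
    fix S' assume "S' \<in> F"
    show "(if S \<inter> S' = {} then 0 else y ^ card (S \<inter> S'))
       \<le> (\<Sum>A\<in>Pow S - {{}}. if A \<subseteq> S' then y ^ card A else 0)"
    proof (cases "S \<inter> S' = {}")
      case True
      then show ?thesis using y by (simp add: sum_nonneg)
    next
      case False
      \<comment> \<open>The single term with A equal to the whole overlap already suffices, since
        all terms are nonnegative.\<close>
      have "(if S \<inter> S' \<subseteq> S' then y ^ card (S \<inter> S') else 0)
          \<le> (\<Sum>A\<in>Pow S - {{}}. if A \<subseteq> S' then y ^ card A else 0)"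
        using False fin y by (intro member_le_sum) auto
      then show ?thesis using False by simp
    qed
  qed
  also have "\<dots> = (\<Sum>A\<in>Pow S - {{}}. \<Sum>S'\<in>F. if A \<subseteq> S' then y ^ card A else 0)"
    by (rule sum.swap)
  also have "\<dots> \<le> (\<Sum>A\<in>Pow S - {{}}. real (n choose i) * w ^ card A)"
  proof (rule sum_mono)
    fix A assume "A \<in> Pow S - {{}}"
    then have A: "A \<subseteq> S" by auto
    then have kA: "card A \<le> i" using S fin card_mono by auto
    have "(\<Sum>S'\<in>F. if A \<subseteq> S' then y ^ card A else 0) = (\<Sum>S'\<in>{S'\<in>F. A \<subseteq> S'}. y ^ card A)"
      using fin by (simp only: sum.inter_filter)
    also have "\<dots> = real (card {S'. A \<subseteq> S' \<and> S' \<subseteq> V \<and> card S' = i}) * y ^ card A"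
      by (simp add: F_def conj_ac)
    also have "\<dots> \<le> real (n - card A choose (i - card A)) * y ^ card A"
      using card_supersets_le[OF V, of A i] A S y unfolding n_def
      by (intro mult_right_mono) auto
    also have "\<dots> \<le> real (n choose i) * w ^ card A"
    proof -
      have "real (n - card A choose (i - card A)) * real n ^ card A \<le> real (n choose i) * real i ^ card A"
        using choose_diff_mult_power_le[OF kA i] by (metis of_nat_le_iff of_nat_mult of_nat_power)
      then have "real (n - card A choose (i - card A)) \<le> real (n choose i) * real i ^ card A / real n ^ card A"
        using n by (simp add: field_simps)
      then have "real (n - card A choose (i - card A)) * y ^ card A
          \<le> real (n choose i) * real i ^ card A / real n ^ card A * y ^ card A"
        using y by (intro mult_right_mono) auto
      also have "\<dots> = real (n choose i) * w ^ card A"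
        by (simp add: w_def power_mult_distrib power_divide)
      finally show ?thesis .
    qed
    finally show "(\<Sum>S'\<in>F. if A \<subseteq> S' then y ^ card A else 0) \<le> real (n choose i) * w ^ card A" .
  qed
  \<comment> \<open>The excluded empty set would contribute w^0 = 1; this is where the -1 comes
    from.\<close>
  also have "\<dots> = real (n choose i) * ((\<Sum>A\<in>Pow S. w ^ card A) - 1)"
    using fin by (simp add: sum_diff1 flip: sum_distrib_left)
  also have "\<dots> = real (n choose i) * ((1 + w) ^ i - 1)"
    using fin S by (simp add: sum_power_card_Pow)
  finally show ?thesis by (simp add: F_def n_def w_def)
qed

section \<open>Product distributions and the second moment method\<close>

lemma prob_all_False:
  assumes "finite A" "D \<subseteq> A" "0 \<le> p" "p \<le> 1"
  shows "measure_pmf.prob (Pi_pmf A False (\<lambda>_. bernoulli_pmf p)) {\<omega>. \<forall>e\<in>D. \<not> \<omega> e} = (1 - p) ^ card D"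
proof -
  \<comment> \<open>Leaving the coordinates off \<open>D\<close> unconstrained turns the event into
    a box, whose probability is a product.\<close>
  define B where "B = (\<lambda>e. if e \<in> D then {False} else UNIV)"
  have "{\<omega>. \<forall>e\<in>D. \<not> \<omega> e} = Pi A B"
    using assms(2) by (auto simp: B_def Pi_def)
  then have "measure_pmf.prob (Pi_pmf A False (\<lambda>_. bernoulli_pmf p)) {\<omega>. \<forall>e\<in>D. \<not> \<omega> e}
      = (\<Prod>e\<in>A. measure_pmf.prob (bernoulli_pmf p) (B e))"
    using assms(1) by (simp add: measure_Pi_pmf_Pi)
  also have "\<dots> = (\<Prod>e\<in>A. if e \<in> D then 1 - p else 1)"
    using assms(3,4) by (intro prod.cong) (auto simp: B_def measure_pmf_single)
  also have "\<dots> = (1 - p) ^ card D"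
    using assms(1,2) by (simp add: prod.If_cases Int_absorb1)
  finally show ?thesis .
qed

text \<open>Chebyshev's inequality for the number X of events that occur, with mean c. The
  hypothesis \<open>pair\<close> bounds each row of the double sum for the second moment, so the
  variance of X/c is at most \<open>\<delta>\<close>.\<close>

lemma second_moment:
  fixes M :: "'a pmf" and A :: "'b \<Rightarrow> 'a set"
  assumes F: "finite F" "F \<noteq> {}" and r: "r > 0"
    and prob: "\<And>f. f \<in> F \<Longrightarrow> measure_pmf.prob M (A f) = r"
    and pair: "\<And>f. f \<in> F \<Longrightarrow>
      (\<Sum>g\<in>F. measure_pmf.prob M (A f \<inter> A g)) \<le> (1 + \<delta>) * (real (card F) * r\<^sup>2)"
  shows "measure_pmf.prob M (\<Union>f\<in>F. A f) \<ge> 1 - \<delta>"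
proof -
  define X where "X = (\<lambda>\<omega>. \<Sum>f\<in>F. indicator (A f) \<omega> :: real)"
  define c where "c = real (card F) * r"
  have c: "c > 0" using F r by (simp add: c_def card_gt_0_iff)
  have int [simp]: "integrable (measure_pmf M) (indicator B :: _ \<Rightarrow> real)" for B
    by (rule measure_pmf.integrable_const_bound[where B = 1]) (auto split: split_indicator)
  have X1: "integrable M X" "(\<integral>\<omega>. X \<omega> \<partial>M) = c"
    unfolding X_def by (auto simp: c_def prob)
  have Xsq: "(\<lambda>\<omega>. (X \<omega>)\<^sup>2) = (\<lambda>\<omega>. \<Sum>f\<in>F. \<Sum>g\<in>F. indicator (A f \<inter> A g) \<omega>)"
    by (simp add: X_def power2_eq_square sum_product indicator_inter_arith)
  have X2: "integrable M (\<lambda>\<omega>. (X \<omega>)\<^sup>2)"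
      "(\<integral>\<omega>. (X \<omega>)\<^sup>2 \<partial>M) = (\<Sum>f\<in>F. \<Sum>g\<in>F. measure_pmf.prob M (A f \<inter> A g))"
    unfolding Xsq by (simp_all add: Bochner_Integration.integral_sum)
  have "(\<integral>\<omega>. (X \<omega>)\<^sup>2 \<partial>M) \<le> (\<Sum>f\<in>F. (1 + \<delta>) * (real (card F) * r\<^sup>2))"
    unfolding X2(2) by (intro sum_mono pair)
  also have "\<dots> = (1 + \<delta>) * c\<^sup>2" by (simp add: c_def power2_eq_square)
  finally have le: "(\<integral>\<omega>. (X \<omega>)\<^sup>2 \<partial>M) \<le> (1 + \<delta>) * c\<^sup>2" .
  have eq: "(\<lambda>\<omega>. (X \<omega> / c - 1)\<^sup>2) = (\<lambda>\<omega>. (X \<omega>)\<^sup>2 / c\<^sup>2 - 2 * X \<omega> / c + 1)"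
    using c by (auto simp: fun_eq_iff power2_diff power_divide)
  have i: "integrable M (\<lambda>\<omega>. (X \<omega> / c - 1)\<^sup>2)"
    unfolding eq using X1(1) X2(1) by simp
  have "(\<integral>\<omega>. (X \<omega> / c - 1)\<^sup>2 \<partial>M) = (\<integral>\<omega>. (X \<omega>)\<^sup>2 \<partial>M) / c\<^sup>2 - 1"
    unfolding eq using X1 X2(1) c by simp
  also have "\<dots> \<le> \<delta>" using le c by (simp add: field_simps)
  finally have le': "(\<integral>\<omega>. (X \<omega> / c - 1)\<^sup>2 \<partial>M) \<le> \<delta>" .
  have "measure_pmf.prob M (- (\<Union>f\<in>F. A f)) = (\<integral>\<omega>. indicator (- (\<Union>f\<in>F. A f)) \<omega> \<partial>M)"
    by simp
  \<comment> \<open>Where no event occurs, X = 0 and the square equals 1.\<close>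
  also have "\<dots> \<le> (\<integral>\<omega>. (X \<omega> / c - 1)\<^sup>2 \<partial>M)"
  proof (rule integral_mono[OF _ i])
    fix \<omega>
    show "indicator (- (\<Union>f\<in>F. A f)) \<omega> \<le> (X \<omega> / c - 1)\<^sup>2"
    proof (cases "\<omega> \<in> (\<Union>f\<in>F. A f)")
      case False
      then have "X \<omega> = 0" by (auto simp: X_def intro!: sum.neutral)
      then show ?thesis using False by simp
    qed simp
  qed simp
  finally have "measure_pmf.prob M (- (\<Union>f\<in>F. A f)) \<le> \<delta>" using le' by linarith
  then show ?thesis using measure_pmf.prob_compl[of "\<Union>f\<in>F. A f" M] by (simp add: Compl_eq_Diff_UNIV)
qed

section \<open>The random graph through edge-free rectangles\<close>

text \<open>The law of the edge indicators, of which \<open>G_bip\<close> is an image; here the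
  independent coordinates are directly accessible.\<close>

definition edge_pmf :: "nat \<Rightarrow> real \<Rightarrow> (vertex \<times> vertex \<Rightarrow> bool) pmf" where
  "edge_pmf n p = Pi_pmf (left_side n \<times> right_side n) False (\<lambda>_. bernoulli_pmf p)"

definition edge_free :: "vertex set \<Rightarrow> vertex set \<Rightarrow> (vertex \<times> vertex \<Rightarrow> bool) set" where
  "edge_free S T = {\<omega>. \<forall>e\<in>S \<times> T. \<not> \<omega> e}"

text \<open>Independence of the set is left out, so this family is deterministic and can index a
  union of events.\<close>

definition balanced_sets :: "nat \<Rightarrow> real \<Rightarrow> nat \<Rightarrow> vertex set set" where
  "balanced_sets n \<gamma> a =
     {I. I \<subseteq> left_side n \<union> right_side n \<and> balanced (left_side n) (right_side n) \<gamma> I \<and> card I = a}"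

lemma finite_sides [simp]: "finite (left_side n)" "finite (right_side n)"
  and card_sides [simp]: "card (left_side n) = n" "card (right_side n) = n"
  and disjoint_sides: "left_side n \<inter> right_side n = {}"
  by (auto simp: left_side_def right_side_def card_image)

lemma finite_balanced_sets: "finite (balanced_sets n \<gamma> a)"
  by (rule finite_subset[of _ "Pow (left_side n \<union> right_side n)"]) (auto simp: balanced_sets_def)

text \<open>A pair in both rectangles has to be a non-edge only once; this overlap is the source of
  the correlation.\<close>

lemma prob_edge_free_Int:
  assumes "0 \<le> p" "p \<le> 1"
    and "S \<subseteq> left_side n" "T \<subseteq> right_side n" "S' \<subseteq> left_side n" "T' \<subseteq> right_side n"
  shows "measure_pmf.prob (edge_pmf n p) (edge_free S T \<inter> edge_free S' T')
           = (1 - p) ^ card (S \<times> T \<union> S' \<times> T')"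
proof -
  have "edge_free S T \<inter> edge_free S' T' = {\<omega>. \<forall>e\<in>S \<times> T \<union> S' \<times> T'. \<not> \<omega> e}"
    by (auto simp: edge_free_def)
  then show ?thesis
    unfolding edge_pmf_def using assms by (simp only:) (rule prob_all_False, auto)
qed

lemma prob_edge_free:
  assumes "0 \<le> p" "p \<le> 1" "S \<subseteq> left_side n" "T \<subseteq> right_side n"
  shows "measure_pmf.prob (edge_pmf n p) (edge_free S T) = (1 - p) ^ (card S * card T)"
  using prob_edge_free_Int[OF assms assms(3,4)] by (simp add: card_cartesian_product)

lemma independent_set_iff_edge_free:
  assumes "I \<subseteq> left_side n \<union> right_side n"
  shows "independent_set (left_side n \<union> right_side n)
           {{u, v} |u v. u \<in> left_side n \<and> v \<in> right_side n \<and> \<omega> (u, v)} I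
         \<longleftrightarrow> \<omega> \<in> edge_free (I \<inter> left_side n) (I \<inter> right_side n)"
    (is "independent_set _ ?E I \<longleftrightarrow> _")
proof
  assume "independent_set (left_side n \<union> right_side n) ?E I"
  then show "\<omega> \<in> edge_free (I \<inter> left_side n) (I \<inter> right_side n)"
    unfolding independent_set_def edge_free_def by blast
next
  assume free: "\<omega> \<in> edge_free (I \<inter> left_side n) (I \<inter> right_side n)"
  have "{u, v} \<notin> ?E" if "u \<in> I" "v \<in> I" for u v
  proof
    assume "{u, v} \<in> ?E"
    then obtain u' v' where *: "{u, v} = {u', v'}" "u' \<in> left_side n" "v' \<in> right_side n" "\<omega> (u', v')"
      by blast
    \<comment> \<open>The unordered pair can match in either orientation; both endpoints lie in
      \<open>I\<close> anyway.\<close>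
    then have "u' \<in> I" "v' \<in> I" using that by (auto simp: doubleton_eq_iff)
    then show False using * free by (auto simp: edge_free_def)
  qed
  then show "independent_set (left_side n \<union> right_side n) ?E I"
    using assms by (simp add: independent_set_def)
qed

text \<open>Entry point of all estimates: a union over a fixed finite family, open to subadditivity
  from above and to monotonicity and second moments from below.\<close>

lemma prob_Z_pos_eq:
  "prob_Z_pos n p \<gamma> a = measure_pmf.prob (edge_pmf n p)
     (\<Union>I\<in>balanced_sets n \<gamma> a. edge_free (I \<inter> left_side n) (I \<inter> right_side n))"
proof -
  define G :: "_ \<Rightarrow> edges" where
    "G = (\<lambda>\<omega>. {{u, v} |u v. u \<in> left_side n \<and> v \<in> right_side n \<and> \<omega> (u, v)})"
  have "Z_bal n \<gamma> a (G \<omega>) \<ge> 1 \<longleftrightarrow>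
      (\<exists>I\<in>balanced_sets n \<gamma> a. \<omega> \<in> edge_free (I \<inter> left_side n) (I \<inter> right_side n))" for \<omega>
  proof -
    define X where "X = {I \<in> balanced_sets n \<gamma> a. \<omega> \<in> edge_free (I \<inter> left_side n) (I \<inter> right_side n)}"
    have "{I. independent_set (left_side n \<union> right_side n) (G \<omega>) I \<and>
        balanced (left_side n) (right_side n) \<gamma> I \<and> card I = a} = X"
      unfolding X_def G_def balanced_sets_def
      using independent_set_iff_edge_free[of _ n \<omega>] independent_set_def[of "left_side n \<union> right_side n"]
      by blast
    \<comment> \<open>Needed because \<open>card\<close> is 0 on infinite sets, so a positive count
      and nonemptiness agree only for finite sets.\<close>
    moreover have "finite X" using finite_balanced_sets by (simp add: X_def)
    ultimately have "Z_bal n \<gamma> a (G \<omega>) \<ge> 1 \<longleftrightarrow> X \<noteq> {}"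
      by (simp add: Z_bal_def Suc_le_eq card_gt_0_iff)
    then show ?thesis by (auto simp: X_def)
  qed
  then have "G -` {E. Z_bal n \<gamma> a E \<ge> 1} =
      (\<Union>I\<in>balanced_sets n \<gamma> a. edge_free (I \<inter> left_side n) (I \<inter> right_side n))"
    by auto
  then show ?thesis
    by (simp add: prob_Z_pos_def G_bip_def edge_pmf_def flip: G_def)
qed

section \<open>The union bound at fixed n\<close>

text \<open>With x + y = a, the product xy equals \<open>\<gamma>\<close>(1 -
  \<open>\<gamma>\<close>)a^2 + (x - \<open>\<gamma>\<close>a)(y - \<open>\<gamma>\<close>a).
  Balance makes one factor of the error less than 1 in absolute value; the other is at most
  a.\<close>

lemma balanced_card_mult_ge:
  assumes "I \<in> balanced_sets n \<gamma> a" "0 \<le> \<gamma>" "\<gamma> \<le> 1"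
  shows "\<gamma> * (1 - \<gamma>) * (real a)\<^sup>2 - real a
           \<le> real (card (I \<inter> left_side n) * card (I \<inter> right_side n))"
proof -
  have key: "\<gamma> * (1 - \<gamma>) * (real a)\<^sup>2 - real a \<le> x * y"
    if "\<bar>x - \<gamma> * real a\<bar> < 1" "x + y = real a" "x \<ge> 0" "y \<ge> 0" for x y
  proof -
    have "\<gamma> * real a \<le> 1 * real a" using assms by (intro mult_right_mono) auto
    moreover have "0 \<le> \<gamma> * real a" using assms by simp
    ultimately have "\<bar>y - \<gamma> * real a\<bar> \<le> real a" using that by linarith
    then have "\<bar>(x - \<gamma> * real a) * (y - \<gamma> * real a)\<bar> \<le> 1 * real a"
      unfolding abs_mult using that by (intro mult_mono) auto
    moreover have "x * y = \<gamma> * (1 - \<gamma>) * (real a)\<^sup>2 + (x - \<gamma> * real a) * (y - \<gamma> * real a)"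
      unfolding that(2)[symmetric] by (simp add: algebra_simps power2_eq_square)
    ultimately show ?thesis by linarith
  qed
  have I: "I \<subseteq> left_side n \<union> right_side n" "balanced (left_side n) (right_side n) \<gamma> I" "card I = a"
    using assms(1) by (auto simp: balanced_sets_def)
  then have "finite I" using finite_subset by fastforce
  moreover have "I = (I \<inter> left_side n) \<union> (I \<inter> right_side n)" using I by auto
  ultimately have "a = card (I \<inter> left_side n) + card (I \<inter> right_side n)"
    using I(3) disjoint_sides[of n]
      card_Un_disjoint[of "I \<inter> left_side n" "I \<inter> right_side n"] by auto
  then have "real (card (I \<inter> left_side n)) + real (card (I \<inter> right_side n)) = real a" by simp
  then show ?thesis
    \<comment> \<open>The two instances of \<open>key\<close> serve the two disjuncts of
      \<open>balanced\<close>.\<close>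
    using I(2) key[of "real (card (I \<inter> left_side n))" "real (card (I \<inter> right_side n))"]
      key[of "real (card (I \<inter> right_side n))" "real (card (I \<inter> left_side n))"]
    unfolding balanced_def I(3) by (auto simp: algebra_simps)
qed

text \<open>The exponent is written with \<open>exp\<close> because the lower bound on the number of
  spanned pairs is real and may be negative.\<close>

lemma prob_Z_pos_le:
  assumes "0 < p" "p < 1" "0 \<le> \<gamma>" "\<gamma> \<le> 1"
  shows "prob_Z_pos n p \<gamma> a
     \<le> real (2 * n) ^ a * exp (- (ln (1 / (1 - p)) * (\<gamma> * (1 - \<gamma>) * (real a)\<^sup>2 - real a)))"
    (is "_ \<le> _ * ?B")
proof -
  have "prob_Z_pos n p \<gamma> a \<le> (\<Sum>I\<in>balanced_sets n \<gamma> a.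
      measure_pmf.prob (edge_pmf n p) (edge_free (I \<inter> left_side n) (I \<inter> right_side n)))"
    unfolding prob_Z_pos_eq
    by (rule measure_pmf.finite_measure_subadditive_finite) (auto simp: finite_balanced_sets)
  also have "\<dots> \<le> (\<Sum>I\<in>balanced_sets n \<gamma> a. ?B)"
  proof (rule sum_mono)
    fix I assume I: "I \<in> balanced_sets n \<gamma> a"
    let ?m = "card (I \<inter> left_side n) * card (I \<inter> right_side n)"
    have "(1 - p) ^ ?m = exp (- (ln (1 / (1 - p)) * real ?m))"
      using assms by (simp add: ln_div exp_of_nat2_mult del: of_nat_mult)
    also have "\<dots> \<le> ?B"
      using assms balanced_card_mult_ge[OF I] by (simp add: ln_div mult_left_mono_neg del: of_nat_mult)
    finally show "measure_pmf.prob (edge_pmf n p) (edge_free (I \<inter> left_side n) (I \<inter> right_side n)) \<le> ?B"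
      using assms by (simp add: prob_edge_free)
  qed
  also have "\<dots> = real (card (balanced_sets n \<gamma> a)) * ?B" by simp
  also have "\<dots> \<le> real (2 * n) ^ a * ?B"
  proof (rule mult_right_mono)
    have "card (balanced_sets n \<gamma> a) \<le> card {I. I \<subseteq> left_side n \<union> right_side n \<and> card I = a}"
      by (rule card_mono) (auto simp: balanced_sets_def)
    also have "\<dots> = (2 * n) choose a"
      using disjoint_sides[of n] by (simp add: n_subsets card_Un_disjoint mult_2)
    also have "\<dots> \<le> (2 * n) ^ a"
      using binomial_le_pow[of a "2 * n"] by (cases "a \<le> 2 * n") (auto simp: binomial_eq_0)
    finally show "real (card (balanced_sets n \<gamma> a)) \<le> real (2 * n) ^ a"
      by (metis of_nat_le_iff of_nat_power)
  qed simp
  finally show ?thesis .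
qed

section \<open>Lower bounds at fixed n\<close>

lemma Un_mem_balanced_sets:
  assumes "S \<subseteq> left_side n" "T \<subseteq> right_side n" "card S + card T = a"
    and "\<bar>real (card S) - \<gamma> * real a\<bar> < 1"
  shows "S \<union> T \<in> balanced_sets n \<gamma> a" "(S \<union> T) \<inter> left_side n = S" "(S \<union> T) \<inter> right_side n = T"
proof -
  have fin: "finite S" "finite T" using assms by (auto intro: finite_subset)
  show *: "(S \<union> T) \<inter> left_side n = S" "(S \<union> T) \<inter> right_side n = T"
    using assms disjoint_sides[of n] by auto
  have "S \<inter> T = {}" using assms disjoint_sides[of n] by auto
  then have "card (S \<union> T) = a" using fin assms by (simp add: card_Un_disjoint)
  then show "S \<union> T \<in> balanced_sets n \<gamma> a"
    using assms * by (auto simp: balanced_sets_def balanced_def)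
qed

text \<open>Rounding \<open>\<gamma>\<close>a down makes the other part at most (1 -
  \<open>\<gamma>\<close>)a + 1. The last bound says that ij/a exceeds \<open>\<gamma>\<close>(1 -
  \<open>\<gamma>\<close>)a by at most 1.\<close>

lemma nat_floor_split:
  assumes "0 \<le> \<gamma>" "\<gamma> \<le> 1"
  defines "i \<equiv> \<lambda>a. nat \<lfloor>\<gamma> * real a\<rfloor>"
  shows "i a \<le> a" "\<bar>real (i a) - \<gamma> * real a\<bar> < 1"
    and "real (i a * (a - i a)) \<le> (\<gamma> * (1 - \<gamma>) * real a + 1) * real a"
proof -
  have nn: "0 \<le> \<gamma> * real a" using assms by simp
  have le: "real (i a) \<le> \<gamma> * real a" "\<gamma> * real a < real (i a) + 1"
    using nn by (auto simp: i_def of_nat_nat)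
  moreover have "\<gamma> * real a \<le> 1 * real a" using assms by (intro mult_right_mono) auto
  ultimately show ia: "i a \<le> a" by linarith
  show "\<bar>real (i a) - \<gamma> * real a\<bar> < 1" using le by linarith
  have "real (i a * (a - i a)) \<le> (\<gamma> * real a) * ((1 - \<gamma>) * real a + 1)"
    unfolding of_nat_mult using le ia nn by (intro mult_mono) (auto simp: algebra_simps)
  also have "\<dots> \<le> (\<gamma> * (1 - \<gamma>) * real a + 1) * real a"
    using \<open>\<gamma> * real a \<le> 1 * real a\<close> by (simp add: algebra_simps)
  finally show "real (i a * (a - i a)) \<le> (\<gamma> * (1 - \<gamma>) * real a + 1) * real a" .
qed

text \<open>One set of each kind exists since both parts have at most \<open>a\<close> elements and
  \<open>a \<le> n\<close>. The crude exponent a^2 suffices for the order of log^2 n.\<close>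

lemma prob_Z_pos_ge_power:
  assumes "0 \<le> p" "p \<le> 1" "0 \<le> \<gamma>" "\<gamma> \<le> 1" "a \<le> n"
  shows "prob_Z_pos n p \<gamma> a \<ge> (1 - p) ^ (a * a)"
proof -
  define i where "i = nat \<lfloor>\<gamma> * real a\<rfloor>"
  note i = nat_floor_split(1,2)[OF assms(3,4), of a, folded i_def]
  obtain S where S: "S \<subseteq> left_side n" "card S = i"
    using obtain_subset_with_card_n[of i "left_side n"] i(1) assms(5) by auto
  obtain T where T: "T \<subseteq> right_side n" "card T = a - i"
    using obtain_subset_with_card_n[of "a - i" "right_side n"] assms(5)
    by (metis card_sides(2) diff_le_self le_trans)
  have "card S + card T = a" using S T i by simp
  note * = Un_mem_balanced_sets[OF S(1) T(1) this i(2)[folded S(2)]]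
  have "(1 - p) ^ (a * a) \<le> (1 - p) ^ (i * (a - i))"
    using assms i(1) by (intro power_decreasing mult_le_mono) auto
  also have "\<dots> = measure_pmf.prob (edge_pmf n p) (edge_free S T)"
    using assms S T by (simp add: prob_edge_free)
  also have "\<dots> \<le> prob_Z_pos n p \<gamma> a"
    unfolding prob_Z_pos_eq
    by (rule measure_pmf.finite_measure_mono) (use * in auto)
  finally show ?thesis .
qed

text \<open>Second moment over all products of the two families. By \<open>bound\<close> the
  correlation splits into a left and a right weight, so \<open>\<delta>\<close> is a product of two
  overlap sums, each normalized by its binomial coefficient.\<close>

lemma prob_exists_edge_free_ge:
  fixes p y :: real
  assumes p: "0 < p" "p < 1" and ij: "i \<le> n" "j \<le> n" and y: "y \<ge> 0"
    and bound: "\<And>k l. \<lbrakk>1 \<le> k; k \<le> i; 1 \<le> l; l \<le> j\<rbrakk> \<Longrightarrow> (1 / (1 - p)) ^ (k * l) \<le> y ^ (k + l)"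
  shows "measure_pmf.prob (edge_pmf n p)
      (\<Union>(S, T)\<in>{S. S \<subseteq> left_side n \<and> card S = i} \<times> {T. T \<subseteq> right_side n \<and> card T = j}. edge_free S T)
    \<ge> 1 - ((1 + y * real i / real n) ^ i - 1) * ((1 + y * real j / real n) ^ j - 1)"
    (is "measure_pmf.prob _ (\<Union>(S, T)\<in>?F \<times> ?H. edge_free S T) \<ge> 1 - ?d * ?e")
proof -
  define r where "r = (1 - p) ^ (i * j)"
  \<comment> \<open>The value on disjoint sets is 0, not y^0 = 1: if one overlap is empty, the two
    events are independent and only the 1 in 1 + u u' may remain.\<close>
  define u where "u = (\<lambda>S S' :: vertex set. if S \<inter> S' = {} then 0 else y ^ card (S \<inter> S'))"
  have fin: "finite ?F" "finite ?H" by auto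
  have card: "card ?F = n choose i" "card ?H = n choose j" by (simp_all add: n_subsets)
  have "1 - ?d * ?e \<le> measure_pmf.prob (edge_pmf n p) (\<Union>f\<in>?F \<times> ?H. (\<lambda>(S, T). edge_free S T) f)"
  proof (rule second_moment[where r = r])
    show "finite (?F \<times> ?H)" using fin by simp
    have "?F \<noteq> {}" "?H \<noteq> {}" using ij card by (metis binomial_eq_0_iff card.empty not_le)+
    then show "?F \<times> ?H \<noteq> {}" by simp
    show "r > 0" using p by (simp add: r_def)
  next
    fix f assume "f \<in> ?F \<times> ?H"
    then show "measure_pmf.prob (edge_pmf n p) (case f of (S, T) \<Rightarrow> edge_free S T) = r"
      using p by (auto simp: prob_edge_free r_def)
  next
    fix f assume "f \<in> ?F \<times> ?H"
    then obtain S T where f: "f = (S, T)" and S: "S \<subseteq> left_side n" "card S = i"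
      and T: "T \<subseteq> right_side n" "card T = j" by auto
    have fST: "finite S" "finite T" using S T finite_subset by fastforce+
    have pair: "measure_pmf.prob (edge_pmf n p) (edge_free S T \<inter> edge_free S' T')
        \<le> r\<^sup>2 * (1 + u S S' * u T T')"
      if S': "S' \<in> ?F" and T': "T' \<in> ?H" for S' T'
    proof -
      define k l where "k = card (S \<inter> S')" and "l = card (T \<inter> T')"
      have fST': "finite S'" "finite T'" using S' T' finite_subset by fastforce+
      \<comment> \<open>Inclusion-exclusion for the two rectangles, whose intersection is a k by l
        rectangle.\<close>
      have "card (S \<times> T \<union> S' \<times> T') + card ((S \<times> T) \<inter> (S' \<times> T')) = 2 * (i * j)"
        using card_Un_Int[of "S \<times> T" "S' \<times> T'"] S T S' T' fST fST'
        by (simp add: card_cartesian_product)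
      also have "(S \<times> T) \<inter> (S' \<times> T') = (S \<inter> S') \<times> (T \<inter> T')" by auto
      also have "card \<dots> = k * l" by (simp add: k_def l_def card_cartesian_product)
      finally have "(1 - p) ^ card (S \<times> T \<union> S' \<times> T') * (1 - p) ^ (k * l) = r\<^sup>2"
        by (simp add: r_def flip: power_add power_mult) (simp add: mult.commute)
      then have "(1 - p) ^ card (S \<times> T \<union> S' \<times> T') = r\<^sup>2 * (1 / (1 - p)) ^ (k * l)"
        using p by (simp add: field_simps)
      also have "\<dots> \<le> r\<^sup>2 * (1 + u S S' * u T T')"
      proof (rule mult_left_mono)
        show "(1 / (1 - p)) ^ (k * l) \<le> 1 + u S S' * u T T'"
        proof (cases "S \<inter> S' = {} \<or> T \<inter> T' = {}")
          case True
          then have "k * l = 0" by (auto simp: k_def l_def)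
          then show ?thesis using True by (auto simp: u_def)
        next
          case False
          have "1 \<le> k" "k \<le> i" "1 \<le> l" "l \<le> j"
            using False fST S T by (auto simp: k_def l_def Suc_le_eq card_gt_0_iff intro: card_mono)
          then have "(1 / (1 - p)) ^ (k * l) \<le> y ^ (k + l)" by (rule bound)
          also have "\<dots> = u S S' * u T T'"
            using False by (simp add: u_def k_def l_def power_add)
          finally show ?thesis by simp
        qed
      qed simp
      finally show ?thesis
        using p S T S' T' by (simp add: prob_edge_free_Int)
    qed
    have u0: "u A B \<ge> 0" for A B using y by (simp add: u_def)
    have "(\<Sum>g\<in>?F \<times> ?H. measure_pmf.prob (edge_pmf n p)
          ((case f of (S, T) \<Rightarrow> edge_free S T) \<inter> (case g of (S, T) \<Rightarrow> edge_free S T)))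
        = (\<Sum>S'\<in>?F. \<Sum>T'\<in>?H. measure_pmf.prob (edge_pmf n p) (edge_free S T \<inter> edge_free S' T'))"
      by (simp add: f sum.cartesian_product case_prod_unfold)
    also have "\<dots> \<le> (\<Sum>S'\<in>?F. \<Sum>T'\<in>?H. r\<^sup>2 * (1 + u S S' * u T T'))"
      by (intro sum_mono pair)
    \<comment> \<open>The double sum of the weights factorizes.\<close>
    also have "\<dots> = r\<^sup>2 * (real (card (?F \<times> ?H)) + (\<Sum>S'\<in>?F. u S S') * (\<Sum>T'\<in>?H. u T T'))"
      by (simp add: sum.distrib sum_product card_cartesian_product flip: sum_distrib_left)
    also have "\<dots> \<le> r\<^sup>2 * (real (card (?F \<times> ?H)) + (real (n choose i) * ?d) * (real (n choose j) * ?e))"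
    proof (intro mult_left_mono add_left_mono mult_mono)
      show "(\<Sum>S'\<in>?F. u S S') \<le> real (n choose i) * ?d"
        using sum_overlap_le[OF finite_sides(1) S y] by (simp add: u_def)
      show "(\<Sum>T'\<in>?H. u T T') \<le> real (n choose j) * ?e"
        using sum_overlap_le[OF finite_sides(2) T y] by (simp add: u_def)
      show "0 \<le> real (n choose i) * ?d" using y by simp
    qed (auto intro: sum_nonneg u0)
    also have "\<dots> = (1 + ?d * ?e) * (real (card (?F \<times> ?H)) * r\<^sup>2)"
      using card by (simp add: card_cartesian_product algebra_simps)
    finally show "(\<Sum>g\<in>?F \<times> ?H. measure_pmf.prob (edge_pmf n p)
          ((case f of (S, T) \<Rightarrow> edge_free S T) \<inter> (case g of (S, T) \<Rightarrow> edge_free S T)))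
        \<le> (1 + ?d * ?e) * (real (card (?F \<times> ?H)) * r\<^sup>2)" .
  qed
  then show ?thesis by simp
qed

text \<open>The inequality kl/(k+l) \<le> ij/(i+j) without division: enlarge l to j in the summand
  kli and k to i in the summand lkj.\<close>

lemma mult_bound_mono:
  fixes k l i j :: nat
  assumes "k \<le> i" "l \<le> j"
  shows "k * l * (i + j) \<le> (k + l) * (i * j)"
proof -
  have "k * (l * i) \<le> k * (j * i)" "l * (k * j) \<le> l * (i * j)"
    using assms by (intro mult_le_mono order_refl; simp)+
  then have "k * (l * i) + l * (k * j) \<le> k * (j * i) + l * (i * j)"
    by (rule add_mono)
  then show ?thesis unfolding add_mult_distrib add_mult_distrib2 by (simp only: ac_simps)
qed

text \<open>Linearizes the overlap sums: the power is at most exp(aw), which is at most 1 + aw +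
  (aw)^2 for aw in [0,1].\<close>

lemma power_one_plus_minus_one_le:
  fixes w :: real
  assumes "0 \<le> w" "real a * w \<le> 1"
  shows "(1 + w) ^ a - 1 \<le> 2 * (real a * w)"
proof -
  have "(1 + w) ^ a \<le> exp w ^ a"
    using assms by (intro power_mono exp_ge_add_one_self) auto
  also have "\<dots> = exp (real a * w)" by (simp add: exp_of_nat_mult)
  also have "\<dots> \<le> 1 + real a * w + (real a * w)\<^sup>2"
    using assms by (intro exp_bound) auto
  also have "(real a * w)\<^sup>2 \<le> real a * w"
    using assms mult_left_le[of "real a * w" "real a * w"] by (simp add: power2_eq_square)
  finally show ?thesis by linarith
qed

text \<open>\<open>L\<close> stands for (1 - \<epsilon>) ln n in the application. Each of the two
  overlap sums is at most 2x, whence the error 4x^2.\<close>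

lemma prob_Z_pos_ge:
  fixes p \<gamma> L :: real
  assumes p: "0 < p" "p < 1" and \<gamma>: "0 \<le> \<gamma>" "\<gamma> \<le> 1" and a: "a \<le> n" "0 < n"
    and L: "ln (1 / (1 - p)) * (\<gamma> * (1 - \<gamma>)) * real a \<le> L"
  defines "x \<equiv> exp (ln (1 / (1 - p)) + L) * (real a)\<^sup>2 / real n"
  assumes x: "x \<le> 1"
  shows "prob_Z_pos n p \<gamma> a \<ge> 1 - 4 * x\<^sup>2"
proof -
  define \<beta> y w i where "\<beta> = ln (1 / (1 - p))" and "y = exp (\<beta> + L)"
    and "w = y * real a / real n" and "i = nat \<lfloor>\<gamma> * real a\<rfloor>"
  define j where "j = a - i"
  note i = nat_floor_split[OF \<gamma>, of a, folded i_def, folded j_def]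
  have ij: "i + j = a" using i(1) by (simp add: j_def)
  have \<beta>: "\<beta> > 0" using p by (simp add: \<beta>_def)
  have w: "w \<ge> 0" "real a * w = x"
    using a by (simp_all add: w_def y_def x_def \<beta>_def power2_eq_square)
  \<comment> \<open>The additional \<open>\<beta>\<close> in the exponent of \<open>y\<close> pays
    for the rounding error 1 in ij/a.\<close>
  have bound: "(1 / (1 - p)) ^ (k * l) \<le> y ^ (k + l)"
    if kl: "1 \<le> k" "k \<le> i" "1 \<le> l" "l \<le> j" for k l
  proof -
    have a0: "real a > 0" using kl ij by simp
    have "real (k * l) * real a \<le> real (k + l) * real (i * j)"
      using mult_bound_mono[OF kl(2,4)] unfolding ij by (metis of_nat_le_iff of_nat_mult)
    also have "\<dots> \<le> real (k + l) * ((\<gamma> * (1 - \<gamma>) * real a + 1) * real a)"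
      using i(3) by (intro mult_left_mono) auto
    finally have "real (k * l) \<le> real (k + l) * (\<gamma> * (1 - \<gamma>) * real a + 1)"
      using a0 by (simp only: mult.assoc[symmetric] mult_le_cancel_right_pos)
    then have "\<beta> * real (k * l) \<le> \<beta> * (real (k + l) * (\<gamma> * (1 - \<gamma>) * real a + 1))"
      using \<beta> by (intro mult_left_mono) auto
    also have "\<dots> = real (k + l) * (\<beta> * (\<gamma> * (1 - \<gamma>)) * real a + \<beta>)"
      by (simp add: algebra_simps)
    also have "\<dots> \<le> real (k + l) * (\<beta> + L)"
      using L by (intro mult_left_mono) (auto simp: \<beta>_def)
    finally have "exp (real (k * l) * \<beta>) \<le> exp (real (k + l) * (\<beta> + L))"
      by (simp add: mult.commute)
    moreover have "exp \<beta> = 1 / (1 - p)" using p by (simp add: \<beta>_def)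
    ultimately show ?thesis by (simp only: exp_of_nat_mult y_def)
  qed
  \<comment> \<open>Both part sizes are at most \<open>a\<close>, so one estimate with
    \<open>a\<close> in their place covers the left and the right sum.\<close>
  have pow: "0 \<le> (1 + y * real m / real n) ^ m - 1 \<and> (1 + y * real m / real n) ^ m - 1 \<le> 2 * x"
    if "m \<le> a" for m
  proof
    have y: "y \<ge> 0" by (simp add: y_def)
    then show "0 \<le> (1 + y * real m / real n) ^ m - 1" by simp
    have "y * real m / real n \<le> w"
      unfolding w_def using y that by (intro divide_right_mono mult_left_mono) auto
    then have "(1 + y * real m / real n) ^ m \<le> (1 + w) ^ m"
      using y by (intro power_mono) auto
    also have "\<dots> \<le> (1 + w) ^ a" using w that by (intro power_increasing) auto
    finally show "(1 + y * real m / real n) ^ m - 1 \<le> 2 * x"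
      using power_one_plus_minus_one_le[of w a] w x by simp
  qed
  have "((1 + y * real i / real n) ^ i - 1) * ((1 + y * real j / real n) ^ j - 1) \<le> (2 * x) * (2 * x)"
    using pow[of i] pow[of j] ij by (intro mult_mono) auto
  then have "1 - 4 * x\<^sup>2 \<le> 1 - ((1 + y * real i / real n) ^ i - 1) * ((1 + y * real j / real n) ^ j - 1)"
    by (simp add: power2_eq_square)
  also have "\<dots> \<le> measure_pmf.prob (edge_pmf n p)
      (\<Union>(S, T)\<in>{S. S \<subseteq> left_side n \<and> card S = i} \<times> {T. T \<subseteq> right_side n \<and> card T = j}. edge_free S T)"
    using p ij a by (intro prob_exists_edge_free_ge bound) (auto simp: y_def)
  also have "\<dots> \<le> prob_Z_pos n p \<gamma> a"
    unfolding prob_Z_pos_eq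
  proof (rule measure_pmf.finite_measure_mono)
    show "(\<Union>(S, T)\<in>{S. S \<subseteq> left_side n \<and> card S = i} \<times> {T. T \<subseteq> right_side n \<and> card T = j}. edge_free S T)
      \<subseteq> (\<Union>I\<in>balanced_sets n \<gamma> a. edge_free (I \<inter> left_side n) (I \<inter> right_side n))"
    proof clarify
      fix \<omega> S T
      assume ST: "S \<subseteq> left_side n" "T \<subseteq> right_side n" "i = card S" "j = card T"
        and \<omega>: "\<omega> \<in> edge_free S T"
      have "card S + card T = a" "\<bar>real (card S) - \<gamma> * real a\<bar> < 1"
        using ij i(2) ST by auto
      note * = Un_mem_balanced_sets[OF ST(1,2) this]
      show "\<omega> \<in> (\<Union>I\<in>balanced_sets n \<gamma> a. edge_free (I \<inter> left_side n) (I \<inter> right_side n))"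
        by (rule UN_I[OF *(1)]) (simp only: *(2,3) \<omega>)
    qed
  qed simp
  finally show ?thesis .
qed

section \<open>Asymptotics in n\<close>

lemma alpha_STAT_eq:
  "alpha_STAT p \<gamma> n = ln (real n) / (ln (1 / (1 - p)) * (\<gamma> * (1 - \<gamma>)))"
  by (simp add: alpha_STAT_def log_def)

lemma eventually_prob_Z_pos_le:
  fixes p \<gamma> \<epsilon> :: real
  assumes "0 < p" "p < 1" "0 < \<gamma>" "\<gamma> < 1" "0 < \<epsilon>"
    and \<alpha>: "\<forall>\<^sub>F n in sequentially. real (\<alpha> n) \<ge> (1 + \<epsilon>) * alpha_STAT p \<gamma> n"
  shows "\<exists>c>0. \<forall>\<^sub>F n in sequentially. prob_Z_pos n p \<gamma> (\<alpha> n) \<le> exp (- (c * (ln (real n))\<^sup>2))"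
proof -
  define \<beta> \<kappa> where "\<beta> = ln (1 / (1 - p))" and "\<kappa> = \<beta> * (\<gamma> * (1 - \<gamma>))"
  have \<beta>: "\<beta> > 0" using assms by (simp add: \<beta>_def)
  then have \<kappa>: "\<kappa> > 0" using assms by (simp add: \<kappa>_def)
  \<comment> \<open>Half of the surplus \<open>\<epsilon>\<close> ln n absorbs the constants from
    (2n)^a and from the balance error.\<close>
  have ev: "\<forall>\<^sub>F n :: nat in sequentially. ln 2 + \<beta> \<le> \<epsilon> / 2 * ln (real n)"
    using assms(5) by real_asymp
  have "\<forall>\<^sub>F n in sequentially. prob_Z_pos n p \<gamma> (\<alpha> n) \<le> exp (- (\<epsilon> / (2 * \<kappa>) * (ln (real n))\<^sup>2))"
    using \<alpha> ev eventually_gt_at_top[of 0]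
  proof eventually_elim
    case (elim n)
    define a where "a = \<alpha> n"
    have ln0: "ln (real n) \<ge> 0" using elim(3) by simp
    have a: "(1 + \<epsilon>) * ln (real n) \<le> \<kappa> * real a"
      using elim(1) \<kappa> unfolding alpha_STAT_eq a_def[symmetric] \<beta>_def[symmetric] \<kappa>_def[symmetric]
      by (simp add: field_simps)
    have "prob_Z_pos n p \<gamma> a
        \<le> real (2 * n) ^ a * exp (- (\<beta> * (\<gamma> * (1 - \<gamma>) * (real a)\<^sup>2 - real a)))"
      unfolding \<beta>_def using assms by (intro prob_Z_pos_le) auto
    also have "real (2 * n) ^ a = exp (real a * (ln 2 + ln (real n)))"
      using elim(3) by (simp add: exp_of_nat_mult exp_add)
    also have "\<dots> * exp (- (\<beta> * (\<gamma> * (1 - \<gamma>) * (real a)\<^sup>2 - real a)))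
        = exp (real a * (ln 2 + ln (real n) + \<beta> - \<kappa> * real a))"
      by (simp add: \<kappa>_def algebra_simps power2_eq_square flip: exp_add)
    also have "\<dots> \<le> exp (- (\<epsilon> / (2 * \<kappa>) * (ln (real n))\<^sup>2))"
    proof -
      have "real a * (ln 2 + ln (real n) + \<beta> - \<kappa> * real a) \<le> real a * (- (\<epsilon> / 2 * ln (real n)))"
        using a elim(2) by (intro mult_left_mono) (auto simp: algebra_simps)
      \<comment> \<open>The second factor is nonpositive, so the lower bound on \<open>a\<close>
        gives an upper bound here.\<close>
      also have "\<dots> \<le> (ln (real n) / \<kappa>) * (- (\<epsilon> / 2 * ln (real n)))"
      proof (rule mult_right_mono_neg)
        have "1 * ln (real n) \<le> (1 + \<epsilon>) * ln (real n)"
          using ln0 assms by (intro mult_right_mono) auto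
        then show "ln (real n) / \<kappa> \<le> real a" using a \<kappa> by (simp add: field_simps)
        show "- (\<epsilon> / 2 * ln (real n)) \<le> 0" using ln0 assms by simp
      qed
      finally show ?thesis by (simp add: power2_eq_square mult_ac)
    qed
    finally show ?case by (simp add: a_def)
  qed
  moreover have "\<epsilon> / (2 * \<kappa>) > 0" using assms(5) \<kappa> by simp
  ultimately show ?thesis by blast
qed

text \<open>A size at most D ln n eventually fits into either side, and a single set gives the
  constant \<open>\<beta>\<close> D^2.\<close>

lemma eventually_prob_Z_pos_ge:
  fixes p \<gamma> :: real
  assumes "0 < p" "p < 1" "0 \<le> \<gamma>" "\<gamma> \<le> 1"
    and \<alpha>: "(\<lambda>n. real (\<alpha> n)) \<in> O(\<lambda>n. ln (real n))"
  shows "\<exists>C. \<forall>\<^sub>F n in sequentially. prob_Z_pos n p \<gamma> (\<alpha> n) \<ge> exp (- (C * (ln (real n))\<^sup>2))"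
proof -
  define \<beta> where "\<beta> = ln (1 / (1 - p))"
  have \<beta>: "\<beta> > 0" using assms by (simp add: \<beta>_def)
  obtain D where D: "D > 0" "\<forall>\<^sub>F n in sequentially. norm (real (\<alpha> n)) \<le> D * norm (ln (real n))"
    using \<alpha> by (elim landau_o.bigE)
  have ev: "\<forall>\<^sub>F n :: nat in sequentially. D * ln (real n) \<le> real n"
    by real_asymp
  have "\<forall>\<^sub>F n in sequentially. prob_Z_pos n p \<gamma> (\<alpha> n) \<ge> exp (- (\<beta> * D\<^sup>2 * (ln (real n))\<^sup>2))"
    using D(2) ev eventually_gt_at_top[of 0]
  proof eventually_elim
    case (elim n)
    have le: "real (\<alpha> n) \<le> D * ln (real n)" using elim(1,3) by simp
    then have "(real (\<alpha> n))\<^sup>2 \<le> (D * ln (real n))\<^sup>2" by (intro power_mono) auto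
    then have "\<beta> * real (\<alpha> n * \<alpha> n) \<le> \<beta> * (D * ln (real n))\<^sup>2"
      using \<beta> by (intro mult_left_mono) (auto simp: power2_eq_square)
    then have "exp (- (\<beta> * D\<^sup>2 * (ln (real n))\<^sup>2)) \<le> exp (real (\<alpha> n * \<alpha> n) * (- \<beta>))"
      by (simp add: power_mult_distrib mult_ac)
    also have "\<dots> = exp (- \<beta>) ^ (\<alpha> n * \<alpha> n)" by (rule exp_of_nat_mult)
    also have "exp (- \<beta>) = 1 - p" using assms by (simp add: \<beta>_def ln_div)
    also have "(1 - p) ^ (\<alpha> n * \<alpha> n) \<le> prob_Z_pos n p \<gamma> (\<alpha> n)"
      using assms le elim(2) by (intro prob_Z_pos_ge_power) auto
    finally show ?case .
  qed
  then show ?thesis by blast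
qed

lemma eventually_prob_Z_pos_near_1:
  fixes p \<gamma> \<epsilon> :: real
  assumes "0 < p" "p < 1" "0 < \<gamma>" "\<gamma> < 1" "0 < \<epsilon>"
    and \<alpha>: "\<forall>\<^sub>F n in sequentially. real (\<alpha> n) \<le> (1 - \<epsilon>) * alpha_STAT p \<gamma> n"
  shows "\<forall>\<^sub>F n in sequentially. prob_Z_pos n p \<gamma> (\<alpha> n) \<ge> 1 - exp (- (\<epsilon> * ln (real n)))"
proof -
  define \<beta> \<kappa> where "\<beta> = ln (1 / (1 - p))" and "\<kappa> = \<beta> * (\<gamma> * (1 - \<gamma>))"
  have \<beta>: "\<beta> > 0" using assms by (simp add: \<beta>_def)
  then have \<kappa>: "\<kappa> > 0" using assms by (simp add: \<kappa>_def)
  \<comment> \<open>Bound for the \<open>x\<close> of \<open>prob_Z_pos_ge\<close>, with the size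
    replaced by its upper bound ln n / \<open>\<kappa>\<close>.\<close>
  define h where "h = (\<lambda>n :: nat. exp \<beta> * (ln (real n) / \<kappa>)\<^sup>2 * exp (- (\<epsilon> * ln (real n))))"
  have "\<forall>\<^sub>F n :: nat in sequentially. ln (real n) / \<kappa> \<le> real n"
    using \<kappa> by real_asymp
  moreover have "\<forall>\<^sub>F n :: nat in sequentially. h n \<le> 1"
    unfolding h_def using \<kappa> assms(5) by real_asymp
  \<comment> \<open>Squaring yields n^(-2\<epsilon>); one factor n^(-\<epsilon>) of it swallows the
    powers of ln n.\<close>
  moreover have "\<forall>\<^sub>F n :: nat in sequentially. 4 * (h n)\<^sup>2 \<le> exp (- (\<epsilon> * ln (real n)))"
    unfolding h_def using \<kappa> assms(5) by real_asymp
  ultimately show ?thesis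
    using \<alpha> eventually_gt_at_top[of 0]
  proof eventually_elim
    case (elim n)
    define a where "a = \<alpha> n"
    define x where "x = exp (\<beta> + (1 - \<epsilon>) * ln (real n)) * (real a)\<^sup>2 / real n"
    have ln0: "ln (real n) \<ge> 0" using elim by simp
    have a: "\<kappa> * real a \<le> (1 - \<epsilon>) * ln (real n)"
      using elim(4) \<kappa> unfolding alpha_STAT_eq a_def[symmetric] \<beta>_def[symmetric] \<kappa>_def[symmetric]
      by (simp add: field_simps)
    also have "\<dots> \<le> 1 * ln (real n)" using ln0 assms by (intro mult_right_mono) auto
    finally have a': "real a \<le> ln (real n) / \<kappa>" using \<kappa> by (simp add: field_simps)
    have "exp (\<beta> + (1 - \<epsilon>) * ln (real n)) = exp \<beta> * exp (- (\<epsilon> * ln (real n))) * exp (ln (real n))"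
      by (simp add: algebra_simps flip: exp_add)
    then have "x = exp \<beta> * (real a)\<^sup>2 * exp (- (\<epsilon> * ln (real n)))"
      using elim(5) by (simp add: x_def)
    also have "\<dots> \<le> h n"
      unfolding h_def using a' by (intro mult_right_mono mult_left_mono power_mono) auto
    finally have x: "x \<le> h n" .
    have "x \<ge> 0" by (simp add: x_def)
    then have "4 * x\<^sup>2 \<le> 4 * (h n)\<^sup>2" using x by (intro mult_left_mono power_mono) auto
    then have "1 - exp (- (\<epsilon> * ln (real n))) \<le> 1 - 4 * x\<^sup>2" using elim(3) by simp
    also have "\<dots> \<le> prob_Z_pos n p \<gamma> a"
      unfolding x_def \<beta>_def
    proof (rule prob_Z_pos_ge)
      show "exp (ln (1 / (1 - p)) + (1 - \<epsilon>) * ln (real n)) * (real a)\<^sup>2 / real n \<le> 1"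
        using x elim(2) by (simp add: x_def \<beta>_def)
      show "ln (1 / (1 - p)) * (\<gamma> * (1 - \<gamma>)) * real a \<le> (1 - \<epsilon>) * ln (real n)"
        using a by (simp add: \<kappa>_def \<beta>_def)
      show "a \<le> n" using a' elim(1) by linarith
    qed (use assms elim in auto)
    finally show ?case by (simp add: a_def)
  qed
qed

text \<open>For sizes growing faster than ln n, the bound of \<open>prob_Z_pos_le\<close> falls
  below every exp(-C ln^2 n). The two-sided exponent in (S1) is therefore stated for sizes in O(ln
  n), the upper bound for all sizes.\<close>

theorem theorem3p1:
  fixes p \<gamma> \<epsilon> :: real
  assumes "0 < p" "p < 1" and "0 < \<gamma>" "\<gamma> \<le> 1 / 2" and "0 < \<epsilon>" "\<epsilon> < 1"
  shows
    "(\<forall>\<alpha> :: nat \<Rightarrow> nat.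
        (\<forall>\<^sub>F n in sequentially. real (\<alpha> n) \<ge> (1 + \<epsilon>) * alpha_STAT p \<gamma> n) \<longrightarrow>
          (\<exists>f \<in> nonneg_Omega (\<lambda>n. (ln (real n))\<^sup>2).
             \<forall>\<^sub>F n in sequentially. prob_Z_pos n p \<gamma> (\<alpha> n) \<le> exp (- f n)) \<and>
          ((\<lambda>n. real (\<alpha> n)) \<in> O(\<lambda>n. ln (real n)) \<longrightarrow>
            (\<exists>f \<in> nonneg_Theta (\<lambda>n. (ln (real n))\<^sup>2).
               \<forall>\<^sub>F n in sequentially. prob_Z_pos n p \<gamma> (\<alpha> n) = exp (- f n))))
     \<and>
     (\<forall>\<alpha> :: nat \<Rightarrow> nat.
        (\<forall>\<^sub>F n in sequentially. real (\<alpha> n) \<le> (1 - \<epsilon>) * alpha_STAT p \<gamma> n) \<longrightarrow>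
          (\<exists>f \<in> nonneg_Theta (\<lambda>n. ln (real n)).
             \<forall>\<^sub>F n in sequentially. prob_Z_pos n p \<gamma> (\<alpha> n) \<ge> 1 - exp (- f n)))"
proof (intro conjI allI impI)
  fix \<alpha> :: "nat \<Rightarrow> nat"
  assume "\<forall>\<^sub>F n in sequentially. real (\<alpha> n) \<ge> (1 + \<epsilon>) * alpha_STAT p \<gamma> n"
  then obtain c where c: "c > 0"
    and le: "\<forall>\<^sub>F n in sequentially. prob_Z_pos n p \<gamma> (\<alpha> n) \<le> exp (- (c * (ln (real n))\<^sup>2))"
    using eventually_prob_Z_pos_le[of p \<gamma> \<epsilon> \<alpha>] assms by auto
  have mem: "(\<lambda>n. c * (ln (real n))\<^sup>2) \<in> nonneg_Omega (\<lambda>n. (ln (real n))\<^sup>2)"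
    using c by (simp add: nonneg_Omega_def)
  show "\<exists>f \<in> nonneg_Omega (\<lambda>n. (ln (real n))\<^sup>2).
      \<forall>\<^sub>F n in sequentially. prob_Z_pos n p \<gamma> (\<alpha> n) \<le> exp (- f n)"
    by (rule bexI[OF _ mem]) (rule le)
  assume "(\<lambda>n. real (\<alpha> n)) \<in> O(\<lambda>n. ln (real n))"
  then obtain C
    where ge: "\<forall>\<^sub>F n in sequentially. prob_Z_pos n p \<gamma> (\<alpha> n) \<ge> exp (- (C * (ln (real n))\<^sup>2))"
    using eventually_prob_Z_pos_ge[of p \<gamma> \<alpha>] assms by auto
  \<comment> \<open>Wherever the probability is positive, this is the only exponent giving
    equality.\<close>
  define f where "f = (\<lambda>n. - ln (prob_Z_pos n p \<gamma> (\<alpha> n)))"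
  have pos: "\<forall>\<^sub>F n in sequentially. prob_Z_pos n p \<gamma> (\<alpha> n) > 0"
    using ge by eventually_elim (meson exp_gt_zero less_le_trans)
  have nonneg: "f n \<ge> 0" for n
  proof -
    have "prob_Z_pos n p \<gamma> (\<alpha> n) \<le> 1" "prob_Z_pos n p \<gamma> (\<alpha> n) \<ge> 0"
      by (simp_all add: prob_Z_pos_def)
    \<comment> \<open>Nonnegativity is required at every n; at probability 0 it holds by the
      convention ln 0 = 0.\<close>
    then show ?thesis by (cases "prob_Z_pos n p \<gamma> (\<alpha> n) = 0") (auto simp: f_def)
  qed
  have "f \<in> O(\<lambda>n. (ln (real n))\<^sup>2)"
  \<comment> \<open>The sign of \<open>C\<close> is unknown, but the constant has to be
    positive.\<close>
  proof (rule landau_o.bigI[of "max C 1"])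
    show "\<forall>\<^sub>F n in sequentially. norm (f n) \<le> max C 1 * norm ((ln (real n))\<^sup>2)"
      using ge pos
    proof eventually_elim
      case (elim n)
      have "- (C * (ln (real n))\<^sup>2) \<le> ln (prob_Z_pos n p \<gamma> (\<alpha> n))"
        using elim(1) ln_ge_iff[OF elim(2)] by blast
      then have "f n \<le> C * (ln (real n))\<^sup>2" by (simp add: f_def)
      also have "\<dots> \<le> max C 1 * (ln (real n))\<^sup>2" by (intro mult_right_mono) auto
      finally show ?case using nonneg by simp
    qed
  qed simp
  moreover have "f \<in> \<Omega>(\<lambda>n. (ln (real n))\<^sup>2)"
  proof (rule landau_omega.bigI[OF c])
    show "\<forall>\<^sub>F n in sequentially. norm (f n) \<ge> c * norm ((ln (real n))\<^sup>2)"
      using le pos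
    proof eventually_elim
      case (elim n)
      then have "ln (prob_Z_pos n p \<gamma> (\<alpha> n)) \<le> - (c * (ln (real n))\<^sup>2)"
        by (metis exp_gt_zero ln_exp ln_le_cancel_iff)
      then show ?case using nonneg[of n] by (simp add: f_def)
    qed
  qed
  ultimately have mem: "f \<in> nonneg_Theta (\<lambda>n. (ln (real n))\<^sup>2)"
    using nonneg by (auto simp: nonneg_Theta_def bigtheta_def)
  have eq: "\<forall>\<^sub>F n in sequentially. prob_Z_pos n p \<gamma> (\<alpha> n) = exp (- f n)"
    using pos by eventually_elim (simp add: f_def)
  show "\<exists>f \<in> nonneg_Theta (\<lambda>n. (ln (real n))\<^sup>2).
      \<forall>\<^sub>F n in sequentially. prob_Z_pos n p \<gamma> (\<alpha> n) = exp (- f n)"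
    by (rule bexI[OF _ mem]) (rule eq)
next
  fix \<alpha> :: "nat \<Rightarrow> nat"
  assume "\<forall>\<^sub>F n in sequentially. real (\<alpha> n) \<le> (1 - \<epsilon>) * alpha_STAT p \<gamma> n"
  then have ge: "\<forall>\<^sub>F n in sequentially. prob_Z_pos n p \<gamma> (\<alpha> n) \<ge> 1 - exp (- (\<epsilon> * ln (real n)))"
    using eventually_prob_Z_pos_near_1[of p \<gamma> \<epsilon> \<alpha>] assms by auto
  have "\<epsilon> * ln (real n) \<ge> 0" for n
    \<comment> \<open>At n = 0 the convention ln 0 = 0 is used again.\<close>
    using assms by (cases "n = 0") auto
  then have mem: "(\<lambda>n. \<epsilon> * ln (real n)) \<in> nonneg_Theta (\<lambda>n. ln (real n))"
    using assms by (simp add: nonneg_Theta_def)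
  show "\<exists>f \<in> nonneg_Theta (\<lambda>n. ln (real n)).
      \<forall>\<^sub>F n in sequentially. prob_Z_pos n p \<gamma> (\<alpha> n) \<ge> 1 - exp (- f n)"
    by (rule bexI[OF _ mem]) (rule ge)
qed

end
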